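(* Let $h\ge 2$ be an integer and $q=\exp(i\pi/h)$. Let $\mathcal{H}$ be a complex vector space, $A$ an endomorphism of $\mathcal{H}$ with $A^h=0$, and $\mathcal{H}_I\subset\mathcal{H}$ a linear subspace with $A(\mathcal{H}_I)\subset\mathcal{H}_I$. Let $\mathcal{H}^\bullet$ and the $h$-differential $Q=d+A$ on $\mathcal{H}^\bullet$ be as defined in the context. Then the generalized $Q$-homology of $\mathcal{H}^\bullet$ coincides with the generalized $A$-homology of $\mathcal{H}_I$: for every $k\in\{1,\dots,h-1\}$ one has $$H_{(k)}(\mathcal{H}^\bullet,Q)=H_{(k)}(\mathcal{H}_I,A),$$ the identification being the linear isomorphism induced by the composite inclusion $\mathcal{H}_I\subset\mathcal{H}=\mathcal{H}^0\subset\mathcal{H}^\bullet$.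
   Context: An $h$-differential vector space is a pair $(E,\delta)$ with $E$ a vector space and $\delta$ an endomorphism of $E$ satisfying $\delta^h=0$. Its generalized homology is the family $H_{(k)}(E,\delta)=\ker(\delta^k)/\mathrm{Im}(\delta^{h-k})$, $1\le k\le h-1$. For an $A$-invariant subspace $\mathcal{H}_I$, $H_{(k)}(\mathcal{H}_I,A)=\ker(A^k:\mathcal{H}_I\to\mathcal{H}_I)/A^{h-k}(\mathcal{H}_I)$. The graded vector space $\mathcal{H}^\bullet=\bigoplus_{n\ge 0}\mathcal{H}^n$ is defined by $\mathcal{H}^0=\mathcal{H}$, $\mathcal{H}^n=\mathcal{H}/\mathcal{H}_I$ for $1\le n\le h-1$, and $\mathcal{H}^n=0$ for $n\ge h$. The endomorphism $d$ of degree $1$ of $\mathcal{H}^\bullet$ is: $d=\pi:\mathcal{H}^0\to\mathcal{H}^1$, the canonical projection $\pi:\mathcal{H}\to\mathcal{H}/\mathcal{H}_I$; $d=\mathrm{Id}:\mathcal{H}^n\to\mathcal{H}^{n+1}$ (the identity of $\mathcal{H}/\mathcal{H}_I$) for $1\le n\le h-2$; $d=0$ on $\mathcal{H}^n$ for $n\ge h-1$. One has $d^h=0$. The endomorphism $A$ of $\mathcal{H}=\mathcal{H}^0$ is extended to $\mathcal{H}^\bullet$ (and still denoted $A$) as the unique homogeneous endomorphism of degree $0$ of $\mathcal{H}^\bullet$ that restricts to $A$ on $\mathcal{H}^0$ and satisfies $Ad-q^2dA=0$; explicitly, on $\mathcal{H}^n$ with $1\le n\le h-1$ it is $q^{2n}A_\pi$,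 where $A_\pi$ is the endomorphism of $\mathcal{H}/\mathcal{H}_I$ induced by $A$. Then $Q=d+A$ satisfies $Q^h=0$. *)

theory Defs
  imports Complex_Main "HOL-Algebra.Module" "HOL-Algebra.AbelCoset"
begin

text \<open>Complex vector spaces are modules (in the sense of HOL-Algebra) over the field of complex
  numbers. The ring-multiplication fields \<open>mult\<close> and \<open>one\<close> of the module record play no role in
  the notion of a module; they are left unspecified below.\<close>

definition complex_field :: "complex ring"
  where "complex_field = \<lparr>carrier = UNIV, mult = (*), one = 1, zero = 0, add = (+)\<rparr>"

definition module_hom :: "'c ring \<Rightarrow> ('c, 'a) module \<Rightarrow> ('c, 'b) module \<Rightarrow> ('a \<Rightarrow> 'b) set"
  where "module_hom R M N =
    {f \<in> hom (add_monoid M) (add_monoid N).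
       \<forall>c \<in> carrier R. \<forall>x \<in> carrier M. f (c \<odot>\<^bsub>M\<^esub> x) = c \<odot>\<^bsub>N\<^esub> f x}"

definition module_iso :: "'c ring \<Rightarrow> ('c, 'a) module \<Rightarrow> ('c, 'b) module \<Rightarrow> ('a \<Rightarrow> 'b) set"
  where "module_iso R M N = {f \<in> module_hom R M N. bij_betw f (carrier M) (carrier N)}"

text \<open>The map on cosets \<open>x + U \<mapsto> f x + W\<close> induced by a map \<open>f\<close>. The union ranges over all
  representatives of the given coset; if \<open>f\<close> is additive and maps \<open>U\<close> into \<open>W\<close>, all its members
  are the same coset of \<open>W\<close>.\<close>

definition induced_map :: "('c, 'b) module \<Rightarrow> 'b set \<Rightarrow> ('a \<Rightarrow> 'b) \<Rightarrow> 'a set \<Rightarrow> 'b set"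
  where "induced_map N W f X = (\<Union>x \<in> X. W +>\<^bsub>N\<^esub> f x)"

definition quot_module :: "('c, 'a) module \<Rightarrow> 'a set \<Rightarrow> ('c, 'a set) module"
  where "quot_module M W =
    \<lparr>carrier = a_rcosets\<^bsub>M\<^esub> W, mult = undefined, one = undefined,
     zero = W, add = set_add M,
     smult = (\<lambda>c. induced_map M W (\<lambda>x. c \<odot>\<^bsub>M\<^esub> x))\<rparr>"

definition differential_space :: "nat \<Rightarrow> (complex, 'a) module \<Rightarrow> ('a \<Rightarrow> 'a) \<Rightarrow> bool"
  where "differential_space h E \<delta> \<longleftrightarrow>
    module complex_field E \<and> \<delta> \<in> module_hom complex_field E E \<and>
    (\<forall>x \<in> carrier E. (\<delta> ^^ h) x = \<zero>\<^bsub>E\<^esub>)"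

definition gen_homology ::
  "nat \<Rightarrow> nat \<Rightarrow> (complex, 'a) module \<Rightarrow> ('a \<Rightarrow> 'a) \<Rightarrow> (complex, 'a set) module"
  where "gen_homology h k E \<delta> =
    quot_module (E\<lparr>carrier := a_kernel E E (\<delta> ^^ k)\<rparr>) ((\<delta> ^^ (h - k)) ` carrier E)"

text \<open>The graded space is the direct sum of \<open>H\<close> (degree 0) and of one copy of the quotient
  \<open>H / W\<close> in each degree \<open>n\<close> with \<open>1 \<le> n \<le> h - 1\<close>; the zero spaces in degrees \<open>n \<ge> h\<close> are
  omitted. Its elements are pairs \<open>(x, f)\<close>, where \<open>x\<close> is the component of degree 0 and \<open>f n\<close>
  the component of degree \<open>n\<close>.\<close>

definition graded_space ::
  "nat \<Rightarrow> (complex, 'a) module \<Rightarrow> 'a set \<Rightarrow> (complex, 'a \<times> (nat \<Rightarrow> 'a set)) module"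
  where "graded_space h H W =
    \<lparr>carrier = carrier H \<times> (\<Pi>\<^sub>E n \<in> {1..<h}. carrier (quot_module H W)),
     mult = undefined, one = undefined,
     zero = (\<zero>\<^bsub>H\<^esub>, \<lambda>n \<in> {1..<h}. \<zero>\<^bsub>quot_module H W\<^esub>),
     add = (\<lambda>(x, f) (y, g). (x \<oplus>\<^bsub>H\<^esub> y, \<lambda>n \<in> {1..<h}. f n \<oplus>\<^bsub>quot_module H W\<^esub> g n)),
     smult = (\<lambda>c (x, f). (c \<odot>\<^bsub>H\<^esub> x, \<lambda>n \<in> {1..<h}. c \<odot>\<^bsub>quot_module H W\<^esub> f n))\<rparr>"

definition graded_incl ::
  "nat \<Rightarrow> (complex, 'a) module \<Rightarrow> 'a set \<Rightarrow> 'a \<Rightarrow> 'a \<times> (nat \<Rightarrow> 'a set)"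
  where "graded_incl h H W x = (x, \<lambda>n \<in> {1..<h}. \<zero>\<^bsub>quot_module H W\<^esub>)"

text \<open>The component of degree \<open>n\<close> of \<open>d v\<close> comes from the component of degree \<open>n - 1\<close> of \<open>v\<close>;
  the component of top degree \<open>h - 1\<close> of \<open>v\<close> is killed.\<close>

definition graded_d ::
  "nat \<Rightarrow> (complex, 'a) module \<Rightarrow> 'a set \<Rightarrow>
    'a \<times> (nat \<Rightarrow> 'a set) \<Rightarrow> 'a \<times> (nat \<Rightarrow> 'a set)"
  where "graded_d h H W = (\<lambda>(x, f).
    (\<zero>\<^bsub>H\<^esub>, \<lambda>n \<in> {1..<h}. if n = 1 then W +>\<^bsub>H\<^esub> x else f (n - 1)))"

text \<open>The factors \<open>q ^ (2 * n)\<close> are those forced by \<open>A d = q\<^sup>2 d A\<close>, given \<open>A\<close> in degree 0.\<close>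

definition graded_A ::
  "nat \<Rightarrow> complex \<Rightarrow> (complex, 'a) module \<Rightarrow> 'a set \<Rightarrow> ('a \<Rightarrow> 'a) \<Rightarrow>
    'a \<times> (nat \<Rightarrow> 'a set) \<Rightarrow> 'a \<times> (nat \<Rightarrow> 'a set)"
  where "graded_A h q H W A = (\<lambda>(x, f).
    (A x, \<lambda>n \<in> {1..<h}. q ^ (2 * n) \<odot>\<^bsub>quot_module H W\<^esub> induced_map H W A (f n)))"

definition graded_Q ::
  "nat \<Rightarrow> complex \<Rightarrow> (complex, 'a) module \<Rightarrow> 'a set \<Rightarrow> ('a \<Rightarrow> 'a) \<Rightarrow>
    'a \<times> (nat \<Rightarrow> 'a set) \<Rightarrow> 'a \<times> (nat \<Rightarrow> 'a set)"
  where "graded_Q h q H W A v =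
    graded_d h H W v \<oplus>\<^bsub>graded_space h H W\<^esub> graded_A h q H W A v"

end

theory Submission
  imports Defs
begin

text \<open>
  Write \<open>E\<close> for the graded space and \<open>V = H / H\<^sub>I\<close>. An element of \<open>H\<^sub>I\<close> is killed by the projection
  \<open>d = \<pi>\<close>, so the inclusion intertwines \<open>A\<close> with \<open>Q\<close>. The quotient \<open>E / H\<^sub>I\<close> consists of one copy
  of \<open>V\<close> in each of the degrees \<open>0, ..., h - 1\<close>, and \<open>Q\<close> equals the shift of degrees up to the
  degree-preserving term \<open>A\<close>. By triangularity \<open>E / H\<^sub>I\<close> is thus free over \<open>\<complex>[Q] / (Q\<^sup>h)\<close> on its
  part of degree 0, and a free module has no generalized homology.

  The argument is run inside \<open>E\<close> rather than in the quotient, so that it gives the statement on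
  homology directly. Let \<open>F j\<close> be the subspace where all components of degree at least \<open>j\<close>
  vanish, the component of degree 0 being taken modulo \<open>H\<^sub>I\<close>. Then \<open>F 0\<close> is the copy of \<open>H\<^sub>I\<close>, \<open>F h\<close> is \<open>E\<close>, and \<open>Q\<close> induces
  isomorphisms \<open>F j / F (j - 1) \<cong> F (j + 1) / F j\<close> for \<open>0 < j < h\<close>. Two facts follow:
  \<^item> division with remainder (\<open>Q_pow_quotient_remainder\<close>): every \<open>w\<close> has the form \<open>Q\<^sup>m u + r\<close>
    with \<open>r \<in> F m\<close>;
  \<^item> detection (\<open>in_F_zero_if_Q_pow\<close>): if \<open>r \<in> F j\<close>, \<open>j + m \<le> h\<close> and \<open>Q\<^sup>m r \<in> F 0\<close>, then \<open>r \<in> F 0\<close>.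

  If \<open>Q\<^sup>k w = 0\<close>, divide \<open>w\<close> by \<open>Q\<^sup>h\<^sup>-\<^sup>k\<close>: as \<open>Q\<^sup>h = 0\<close>, the remainder is killed by \<open>Q\<^sup>k\<close>, hence lies
  in \<open>F 0\<close>, so the map on homology is onto. If \<open>Q\<^sup>h\<^sup>-\<^sup>k w \<in> F 0\<close>, divide \<open>w\<close> by \<open>Q\<^sup>k\<close>: the remainder
  has the same image under \<open>Q\<^sup>h\<^sup>-\<^sup>k\<close> and lies in \<open>F 0\<close>, so the map is one-to-one. This is
  \<open>gen_homology_F_zero_iso\<close>.

  The root of unity enters only through \<open>Q\<^sup>h = 0\<close>. It suffices to check this on the part \<open>H\<close> of
  degree 0, which generates \<open>E\<close> under \<open>Q\<close>; there the component of degree \<open>n\<close> of \<open>Q\<^sup>m x\<close> is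
  the class of \<open>A\<^sup>m\<^sup>-\<^sup>n x\<close> times a Gaussian binomial coefficient in \<open>q\<^sup>2\<close>, and for \<open>m = h\<close> and
  \<open>0 < n < h\<close> this coefficient vanishes because \<open>q\<^sup>2\<close> is a primitive \<open>h\<close>-th root of unity.
\<close>

section \<open>Homomorphisms, submodules and quotients\<close>

lemma module_homD:
  assumes "f \<in> module_hom R M N"
  shows "x \<in> carrier M \<Longrightarrow> f x \<in> carrier N"
    and "\<lbrakk>x \<in> carrier M; y \<in> carrier M\<rbrakk> \<Longrightarrow> f (x \<oplus>\<^bsub>M\<^esub> y) = f x \<oplus>\<^bsub>N\<^esub> f y"
    and "\<lbrakk>c \<in> carrier R; x \<in> carrier M\<rbrakk> \<Longrightarrow> f (c \<odot>\<^bsub>M\<^esub> x) = c \<odot>\<^bsub>N\<^esub> f x"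
  using assms by (auto simp: module_hom_def hom_def)

lemma module_homI:
  assumes "\<And>x. x \<in> carrier M \<Longrightarrow> f x \<in> carrier N"
    and "\<And>x y. \<lbrakk>x \<in> carrier M; y \<in> carrier M\<rbrakk> \<Longrightarrow> f (x \<oplus>\<^bsub>M\<^esub> y) = f x \<oplus>\<^bsub>N\<^esub> f y"
    and "\<And>c x. \<lbrakk>c \<in> carrier R; x \<in> carrier M\<rbrakk> \<Longrightarrow> f (c \<odot>\<^bsub>M\<^esub> x) = c \<odot>\<^bsub>N\<^esub> f x"
  shows "f \<in> module_hom R M N"
  using assms by (auto simp: module_hom_def hom_def)

lemma module_hom_zero:
  assumes "module R M" "module R N" "f \<in> module_hom R M N"
  shows "f \<zero>\<^bsub>M\<^esub> = \<zero>\<^bsub>N\<^esub>"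
proof -
  interpret M: module R M by fact
  interpret N: module R N by fact
  have "f (\<zero>\<^bsub>R\<^esub> \<odot>\<^bsub>M\<^esub> \<zero>\<^bsub>M\<^esub>) = \<zero>\<^bsub>R\<^esub> \<odot>\<^bsub>N\<^esub> f \<zero>\<^bsub>M\<^esub>"
    by (intro module_homD(3)[OF assms(3)]) auto
  then show ?thesis
    using module_homD(1)[OF assms(3)] by simp
qed

lemma module_hom_minus:
  assumes "module R M" "module R N" "f \<in> module_hom R M N" "x \<in> carrier M" "y \<in> carrier M"
  shows "f (x \<ominus>\<^bsub>M\<^esub> y) = f x \<ominus>\<^bsub>N\<^esub> f y"
proof -
  interpret M: module R M by fact
  interpret N: module R N by fact
  note D = module_homD[OF assms(3)]
  have "f (x \<ominus>\<^bsub>M\<^esub> y) \<oplus>\<^bsub>N\<^esub> f y = f x"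
    using assms(4,5) D(2)[of "x \<ominus>\<^bsub>M\<^esub> y" y]
    by (simp add: M.M.minus_eq M.M.a_assoc M.M.l_neg)
  then have "f (x \<ominus>\<^bsub>M\<^esub> y) \<oplus>\<^bsub>N\<^esub> f y \<ominus>\<^bsub>N\<^esub> f y = f x \<ominus>\<^bsub>N\<^esub> f y" by simp
  then show ?thesis
    using assms(4,5) D(1) by (simp add: N.M.minus_eq N.M.a_assoc N.M.r_neg)
qed

lemma module_hom_funpow:
  assumes "f \<in> module_hom R M M"
  shows "f ^^ n \<in> module_hom R M M"
proof (induction n)
  case 0
  show ?case by (auto intro: module_homI)
next
  case (Suc n)
  show ?case
    using module_homD[OF assms] module_homD[OF Suc.IH] by (auto intro!: module_homI)
qed

lemma submodule_image:
  assumes "module R M" "module R N" "f \<in> module_hom R M N"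
  shows "submodule (f ` carrier M) R N"
proof -
  interpret M: module R M by fact
  interpret N: module R N by fact
  note D = module_homD[OF assms(3)]
  have f0: "f \<zero>\<^bsub>M\<^esub> = \<zero>\<^bsub>N\<^esub>" by (rule module_hom_zero[OF assms])
  show ?thesis
  proof (rule N.submoduleI)
    show "f ` carrier M \<subseteq> carrier N" using D by auto
    show "\<zero>\<^bsub>N\<^esub> \<in> f ` carrier M" using f0 by (metis M.M.zero_closed image_eqI)
    fix a assume "a \<in> f ` carrier M"
    then obtain x where x: "x \<in> carrier M" "a = f x" by auto
    have "\<ominus>\<^bsub>N\<^esub> a = f (\<ominus>\<^bsub>M\<^esub> x)"
      using x D(1) f0 module_hom_minus[OF assms, of "\<zero>\<^bsub>M\<^esub>" x]
      by (simp add: M.M.minus_eq N.M.minus_eq)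
    then show "\<ominus>\<^bsub>N\<^esub> a \<in> f ` carrier M" using x by auto
    {
      fix b assume "b \<in> f ` carrier M"
      then obtain y where "y \<in> carrier M" "b = f y" by auto
      then show "a \<oplus>\<^bsub>N\<^esub> b \<in> f ` carrier M"
        using x D(2)[of x y] by (metis M.M.add.m_closed image_eqI)
    }
    {
      fix c assume "c \<in> carrier R"
      then show "c \<odot>\<^bsub>N\<^esub> a \<in> f ` carrier M"
        using x D(3)[of c x] by (metis M.smult_closed image_eqI)
    }
  qed
qed

lemma submodule_a_kernel:
  assumes "module R M" "module R N" "f \<in> module_hom R M N"
  shows "submodule (a_kernel M N f) R M"
proof -
  interpret M: module R M by fact
  interpret N: module R N by fact
  note D = module_homD[OF assms(3)]
  have f0: "f \<zero>\<^bsub>M\<^esub> = \<zero>\<^bsub>N\<^esub>" by (rule module_hom_zero[OF assms])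
  have minus: "f (\<ominus>\<^bsub>M\<^esub> x) = \<ominus>\<^bsub>N\<^esub> f x" if "x \<in> carrier M" for x
    using that D(1) f0 module_hom_minus[OF assms, of "\<zero>\<^bsub>M\<^esub>" x]
    by (simp add: M.M.minus_eq N.M.minus_eq)
  show ?thesis
    by (rule M.submoduleI) (use f0 minus D in \<open>auto simp: a_kernel_def'\<close>)
qed

lemma (in module) submodule_abelian_subgroup:
  assumes "submodule W R M"
  shows "abelian_subgroup W M"
  using assms
  by (intro abelian_subgroupI3 additive_subgroupI M.abelian_group_axioms submodule.axioms(1))

lemma (in module) submodule_within:
  assumes "submodule U R M" "submodule V R M" "U \<subseteq> V"
  shows "submodule U R (M\<lparr>carrier := V\<rparr>)"
proof -
  interpret V: module R "M\<lparr>carrier := V\<rparr>"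
    using assms(2) module_axioms by (rule submodule.submodule_is_module)
  interpret U: module R "M\<lparr>carrier := U\<rparr>"
    using assms(1) module_axioms by (rule submodule.submodule_is_module)
  show ?thesis
    by (rule V.module_incl_imp_submodule) (use assms(3) U.module_axioms in auto)
qed

text \<open>The module axioms are equational apart from the existence of additive inverses, so they pass
  to any structure that is the image of a module under a map compatible with the operations.\<close>

lemma module_surj_image:
  fixes M :: "('c, 'a) module" and N :: "('c, 'b) module"
  assumes "module R M" and "carrier N = f ` carrier M"
    and "\<And>x y. \<lbrakk>x \<in> carrier M; y \<in> carrier M\<rbrakk> \<Longrightarrow> f x \<oplus>\<^bsub>N\<^esub> f y = f (x \<oplus>\<^bsub>M\<^esub> y)"
    and "\<zero>\<^bsub>N\<^esub> = f \<zero>\<^bsub>M\<^esub>"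
    and "\<And>c x. \<lbrakk>c \<in> carrier R; x \<in> carrier M\<rbrakk> \<Longrightarrow> c \<odot>\<^bsub>N\<^esub> f x = f (c \<odot>\<^bsub>M\<^esub> x)"
  shows "module R N"
proof -
  interpret M: module R M by fact
  have "\<exists>y\<in>carrier M. f y \<oplus>\<^bsub>N\<^esub> f x = f \<zero>\<^bsub>M\<^esub>" if "x \<in> carrier M" for x
    using that assms(3)[of "\<ominus>\<^bsub>M\<^esub> x" x] by (auto intro!: bexI[of _ "\<ominus>\<^bsub>M\<^esub> x"] simp: M.M.l_neg)
  then have "abelian_group N"
    by (intro abelian_groupI)
      (auto simp: assms(2-4) M.M.a_assoc M.M.a_comm M.M.a_lcomm)
  then show ?thesis
    by (intro moduleI module.axioms(1)[OF assms(1)])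
      (auto simp: assms(2-) M.smult_l_distr M.smult_r_distr M.smult_assoc1)
qed

context module
begin

lemma coset_eq_iff:
  assumes "submodule W R M" "x \<in> carrier M" "y \<in> carrier M"
  shows "W +>\<^bsub>M\<^esub> x = W +>\<^bsub>M\<^esub> y \<longleftrightarrow> x \<ominus>\<^bsub>M\<^esub> y \<in> W"
proof -
  interpret W: abelian_subgroup W M using assms(1) by (rule submodule_abelian_subgroup)
  have "W +>\<^bsub>M\<^esub> x = W +>\<^bsub>M\<^esub> y \<longleftrightarrow> x \<in> W +>\<^bsub>M\<^esub> y"
    using W.a_rcos_self[OF assms(2)] W.a_repr_independence'[of x y] assms(3) by auto
  also have "\<dots> \<longleftrightarrow> x \<ominus>\<^bsub>M\<^esub> y \<in> W"
    using W.a_rcos_module[OF assms(3,2)] by (simp add: M.minus_eq)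
  finally show ?thesis .
qed

lemma coset_eq_self_iff:
  assumes "submodule W R M" "x \<in> carrier M"
  shows "W +>\<^bsub>M\<^esub> x = W \<longleftrightarrow> x \<in> W"
  using M.a_coset_join1[OF _ assms(2) submodule.axioms(1)[OF assms(1)]]
    M.a_coset_join2[OF assms(2) submodule.axioms(1)[OF assms(1)]] by auto

lemma coset_add:
  assumes "submodule W R M" "x \<in> carrier M" "y \<in> carrier M"
  shows "(W +>\<^bsub>M\<^esub> x) <+>\<^bsub>M\<^esub> (W +>\<^bsub>M\<^esub> y) = W +>\<^bsub>M\<^esub> (x \<oplus>\<^bsub>M\<^esub> y)"
  using assms abelian_subgroup.a_rcos_sum[OF submodule_abelian_subgroup] by blast

end

text \<open>The union over all representatives in \<^const>\<open>induced_map\<close> is a single coset, because two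
  representatives differ by an element of \<open>U\<close>, whose image lies in \<open>W\<close>.\<close>

lemma induced_map_coset:
  assumes "module R M" "module R N" "f \<in> module_hom R M N"
    and "submodule U R M" "submodule W R N" "f ` U \<subseteq> W" "x \<in> carrier M"
  shows "induced_map N W f (U +>\<^bsub>M\<^esub> x) = W +>\<^bsub>N\<^esub> f x"
proof -
  interpret M: module R M by fact
  interpret N: module R N by fact
  note U = M.submoduleE[OF assms(4)] and D = module_homD[OF assms(3)]
  have "W +>\<^bsub>N\<^esub> f (u \<oplus>\<^bsub>M\<^esub> x) = W +>\<^bsub>N\<^esub> f x" if u: "u \<in> U" for u
  proof -
    have "f (u \<oplus>\<^bsub>M\<^esub> x) \<ominus>\<^bsub>N\<^esub> f x = f u"
      using u U(1) assms(7) D(1) D(2)[of u x]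
      by (auto simp: subset_iff N.M.minus_eq N.M.a_assoc N.M.r_neg)
    then show ?thesis
      using u U(1) assms(6,7) D(1) N.coset_eq_iff[OF assms(5)] by (auto simp: subset_iff)
  qed
  then show ?thesis
    using U(2) by (auto simp: induced_map_def a_r_coset_def'[of M])
qed

lemma smult_module_hom:
  assumes "module R M" "c \<in> carrier R"
  shows "(\<lambda>x. c \<odot>\<^bsub>M\<^esub> x) \<in> module_hom R M M"
proof -
  interpret M: module R M by fact
  have swap: "c \<odot>\<^bsub>M\<^esub> (d \<odot>\<^bsub>M\<^esub> x) = d \<odot>\<^bsub>M\<^esub> (c \<odot>\<^bsub>M\<^esub> x)" if "d \<in> carrier R" "x \<in> carrier M" for d x
    using M.smult_assoc1[of c d x] M.smult_assoc1[of d c x] M.R.m_comm[of c d] assms(2) that by simp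
  show ?thesis
    by (rule module_homI)
      (rule M.smult_closed M.smult_r_distr swap assms(2) | assumption)+
qed

context
  fixes R :: "'c ring" and M :: "('c, 'a) module" and W :: "'a set"
  assumes M: "module R M" and W: "submodule W R M"
begin

interpretation M: module R M by (rule M)

lemma quot_module_carrier: "carrier (quot_module M W) = (\<lambda>x. W +>\<^bsub>M\<^esub> x) ` carrier M"
  by (simp add: quot_module_def A_RCOSETS_def' UNION_singleton_eq_range)

lemma quot_module_zero: "\<zero>\<^bsub>quot_module M W\<^esub> = W"
  by (simp add: quot_module_def)

lemma quot_module_add:
  "\<lbrakk>x \<in> carrier M; y \<in> carrier M\<rbrakk> \<Longrightarrow>
    (W +>\<^bsub>M\<^esub> x) \<oplus>\<^bsub>quot_module M W\<^esub> (W +>\<^bsub>M\<^esub> y) = W +>\<^bsub>M\<^esub> (x \<oplus>\<^bsub>M\<^esub> y)"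
  using M.coset_add[OF W] by (simp add: quot_module_def)

lemma quot_module_smult:
  "\<lbrakk>c \<in> carrier R; x \<in> carrier M\<rbrakk> \<Longrightarrow>
    c \<odot>\<^bsub>quot_module M W\<^esub> (W +>\<^bsub>M\<^esub> x) = W +>\<^bsub>M\<^esub> (c \<odot>\<^bsub>M\<^esub> x)"
proof -
  assume c: "c \<in> carrier R" and x: "x \<in> carrier M"
  have "(\<lambda>x. c \<odot>\<^bsub>M\<^esub> x) ` W \<subseteq> W"
    using M.submoduleE(4)[OF W c] by blast
  from induced_map_coset[OF M M smult_module_hom[OF M c] W W this x] show ?thesis
    by (simp add: quot_module_def)
qed

lemma module_quot_module: "module R (quot_module M W)"
proof (rule module_surj_image[OF M quot_module_carrier quot_module_add _ quot_module_smult])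
  have "\<zero>\<^bsub>M\<^esub> \<in> W" using subgroup.one_closed[OF submodule.axioms(1)[OF W]] by simp
  then show "\<zero>\<^bsub>quot_module M W\<^esub> = W +>\<^bsub>M\<^esub> \<zero>\<^bsub>M\<^esub>"
    using M.coset_eq_self_iff[OF W M.M.zero_closed] by (simp add: quot_module_zero)
qed

end

lemma induced_map_module_hom:
  fixes R :: "'c ring" and M :: "('c, 'a) module" and N :: "('c, 'b) module"
  assumes M: "module R M" and N: "module R N" and f: "f \<in> module_hom R M N"
    and U: "submodule U R M" and W: "submodule W R N" and fU: "f ` U \<subseteq> W"
  shows "induced_map N W f \<in> module_hom R (quot_module M U) (quot_module N W)"
proof -
  interpret M: module R M by fact
  interpret N: module R N by fact
  note D = module_homD[OF f]
  note cos = induced_map_coset[OF M N f U W fU]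
  show ?thesis
    by (rule module_homI)
      (auto simp: quot_module_carrier[OF M U] quot_module_carrier[OF N W] quot_module_add[OF M U]
        quot_module_add[OF N W] quot_module_smult[OF M U] quot_module_smult[OF N W] cos D)
qed

text \<open>The hypotheses \<open>inj\<close> and \<open>surj\<close> say that \<open>f\<close> induces an injection and a surjection on the
  quotients; they are phrased with representatives because that is how they arise for homology.\<close>

lemma induced_map_module_iso:
  fixes R :: "'c ring" and M :: "('c, 'a) module" and N :: "('c, 'b) module"
  assumes M: "module R M" and N: "module R N" and f: "f \<in> module_hom R M N"
    and U: "submodule U R M" and W: "submodule W R N" and fU: "f ` U \<subseteq> W"
    and inj: "\<And>x. \<lbrakk>x \<in> carrier M; f x \<in> W\<rbrakk> \<Longrightarrow> x \<in> U"
    and surj: "\<And>y. y \<in> carrier N \<Longrightarrow> \<exists>w\<in>W. \<exists>x\<in>carrier M. y = w \<oplus>\<^bsub>N\<^esub> f x"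
  shows "induced_map N W f \<in> module_iso R (quot_module M U) (quot_module N W)"
proof -
  interpret M: module R M by fact
  interpret N: module R N by fact
  note D = module_homD[OF f]
  note cos = induced_map_coset[OF M N f U W fU]
  have "inj_on (induced_map N W f) (carrier (quot_module M U))"
  proof (rule inj_onI)
    fix X Y
    assume "X \<in> carrier (quot_module M U)" "Y \<in> carrier (quot_module M U)"
    then obtain x y where xy: "x \<in> carrier M" "y \<in> carrier M" "X = U +>\<^bsub>M\<^esub> x" "Y = U +>\<^bsub>M\<^esub> y"
      by (auto simp: quot_module_carrier[OF M U])
    assume "induced_map N W f X = induced_map N W f Y"
    then have "f x \<ominus>\<^bsub>N\<^esub> f y \<in> W"
      using xy cos D(1) N.coset_eq_iff[OF W] by simp
    then have "f (x \<ominus>\<^bsub>M\<^esub> y) \<in> W"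
      using module_hom_minus[OF M N f] xy by simp
    then show "X = Y"
      using xy inj M.coset_eq_iff[OF U] by simp
  qed
  moreover have "carrier (quot_module N W) \<subseteq> induced_map N W f ` carrier (quot_module M U)"
  proof
    fix Y assume "Y \<in> carrier (quot_module N W)"
    then obtain y where y: "y \<in> carrier N" "Y = W +>\<^bsub>N\<^esub> y"
      by (auto simp: quot_module_carrier[OF N W])
    obtain w x where wx: "w \<in> W" "x \<in> carrier M" "y = w \<oplus>\<^bsub>N\<^esub> f x"
      using surj y(1) by blast
    then have "y \<ominus>\<^bsub>N\<^esub> f x = w"
      using N.submoduleE(1)[OF W] D(1) by (auto simp: subset_iff N.M.minus_eq N.M.a_assoc N.M.r_neg)
    then have "Y = induced_map N W f (U +>\<^bsub>M\<^esub> x)"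
      using cos y wx N.coset_eq_iff[OF W] D(1) by simp
    then show "Y \<in> induced_map N W f ` carrier (quot_module M U)"
      using wx(2) by (auto simp: quot_module_carrier[OF M U])
  qed
  ultimately show ?thesis
    using induced_map_module_hom[OF M N f U W fU] module_homD(1)
    by (fastforce simp: module_iso_def bij_betw_def)
qed

section \<open>Generalized homology\<close>

lemma a_kernel_iff: "x \<in> a_kernel M N f \<longleftrightarrow> x \<in> carrier M \<and> f x = \<zero>\<^bsub>N\<^esub>"
  by (simp add: a_kernel_def')

text \<open>The isomorphism is induced by the restriction of \<open>i\<close> to the kernels of \<open>A ^^ k\<close> and
  \<open>Q ^^ k\<close>. These are modules in their own right, and they contain the images of \<open>A ^^ (h - k)\<close> and
  \<open>Q ^^ (h - k)\<close> because the \<open>h\<close>-th powers vanish.\<close>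

lemma gen_homology_iso:
  fixes L :: "(complex, 'a) module" and E :: "(complex, 'b) module"
  assumes L: "differential_space h L A" and E: "differential_space h E Q"
    and i: "i \<in> module_hom complex_field L E"
    and comm: "\<And>x. x \<in> carrier L \<Longrightarrow> i (A x) = Q (i x)"
    and k: "k \<le> h"
    and inj: "\<And>x u. \<lbrakk>x \<in> carrier L; u \<in> carrier E; i x = (Q ^^ (h - k)) u\<rbrakk>
      \<Longrightarrow> x \<in> (A ^^ (h - k)) ` carrier L"
    and surj: "\<And>y. \<lbrakk>y \<in> carrier E; (Q ^^ k) y = \<zero>\<^bsub>E\<^esub>\<rbrakk>
      \<Longrightarrow> \<exists>u\<in>carrier E. \<exists>x\<in>carrier L. (A ^^ k) x = \<zero>\<^bsub>L\<^esub> \<and> y = (Q ^^ (h - k)) u \<oplus>\<^bsub>E\<^esub> i x"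
  shows "\<exists>\<phi>\<in>module_iso complex_field (gen_homology h k L A) (gen_homology h k E Q).
    \<forall>x\<in>a_kernel L L (A ^^ k).
      \<phi> ((A ^^ (h - k)) ` carrier L +>\<^bsub>L\<^esub> x) = (Q ^^ (h - k)) ` carrier E +>\<^bsub>E\<^esub> i x"
proof -
  have Lm: "module complex_field L" and A: "A \<in> module_hom complex_field L L"
    and Ah: "\<And>x. x \<in> carrier L \<Longrightarrow> (A ^^ h) x = \<zero>\<^bsub>L\<^esub>"
    using L by (auto simp: differential_space_def)
  have Em: "module complex_field E" and Q: "Q \<in> module_hom complex_field E E"
    and Qh: "\<And>x. x \<in> carrier E \<Longrightarrow> (Q ^^ h) x = \<zero>\<^bsub>E\<^esub>"
    using E by (auto simp: differential_space_def)
  interpret L: module complex_field L by (rule Lm)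
  interpret E: module complex_field E by (rule Em)
  note i_D = module_homD[OF i]
  note A_D = module_homD[OF module_hom_funpow[OF A]] and Q_D = module_homD[OF module_hom_funpow[OF Q]]
  have pow_comm: "i ((A ^^ n) x) = (Q ^^ n) (i x)" if "x \<in> carrier L" for n x
    by (induction n) (use that A_D comm in auto)
  define KL where "KL = L\<lparr>carrier := a_kernel L L (A ^^ k)\<rparr>"
  define KE where "KE = E\<lparr>carrier := a_kernel E E (Q ^^ k)\<rparr>"
  define U where "U = (A ^^ (h - k)) ` carrier L"
  define W where "W = (Q ^^ (h - k)) ` carrier E"
  have subL: "submodule (a_kernel L L (A ^^ k)) complex_field L"
    by (rule submodule_a_kernel[OF Lm Lm module_hom_funpow[OF A]])
  have subE: "submodule (a_kernel E E (Q ^^ k)) complex_field E"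
    by (rule submodule_a_kernel[OF Em Em module_hom_funpow[OF Q]])
  have KLm: "module complex_field KL"
    unfolding KL_def using subL Lm by (rule submodule.submodule_is_module)
  have KEm: "module complex_field KE"
    unfolding KE_def using subE Em by (rule submodule.submodule_is_module)
  interpret KL: module complex_field KL by (rule KLm)
  have hk: "h = k + (h - k)" using k by simp
  have "(A ^^ k) ((A ^^ (h - k)) x) = \<zero>\<^bsub>L\<^esub>" if "x \<in> carrier L" for x
    using Ah[OF that] hk by (metis funpow_add comp_apply)
  then have "U \<subseteq> a_kernel L L (A ^^ k)"
    using A_D(1) by (auto simp: U_def a_kernel_iff)
  then have Usub: "submodule U complex_field KL"
    unfolding KL_def U_def
    by (intro L.submodule_within submodule_image[OF Lm Lm module_hom_funpow[OF A]] subL)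
  have "(Q ^^ k) ((Q ^^ (h - k)) x) = \<zero>\<^bsub>E\<^esub>" if "x \<in> carrier E" for x
    using Qh[OF that] hk by (metis funpow_add comp_apply)
  then have "W \<subseteq> a_kernel E E (Q ^^ k)"
    using Q_D(1) by (auto simp: W_def a_kernel_iff)
  then have Wsub: "submodule W complex_field KE"
    unfolding KE_def W_def
    by (intro E.submodule_within submodule_image[OF Em Em module_hom_funpow[OF Q]] subE)
  have i0: "i \<zero>\<^bsub>L\<^esub> = \<zero>\<^bsub>E\<^esub>" by (rule module_hom_zero[OF Lm Em i])
  have iK: "i \<in> module_hom complex_field KL KE"
    by (rule module_homI)
      (use i_D i0 pow_comm[of _ k] in \<open>auto simp: KL_def KE_def a_kernel_iff simp flip: pow_comm\<close>)
  have iU: "i ` U \<subseteq> W"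
    using i_D(1) by (auto simp: U_def W_def pow_comm)
  have "induced_map KE W i \<in> module_iso complex_field (quot_module KL U) (quot_module KE W)"
  proof (rule induced_map_module_iso[OF KLm KEm iK Usub Wsub iU])
    show "x \<in> U" if "x \<in> carrier KL" "i x \<in> W" for x
      using that inj by (auto simp: U_def W_def KL_def a_kernel_iff)
    show "\<exists>w\<in>W. \<exists>x\<in>carrier KL. y = w \<oplus>\<^bsub>KE\<^esub> i x" if "y \<in> carrier KE" for y
      using that surj[of y] by (fastforce simp: W_def KL_def KE_def a_kernel_iff)
  qed
  moreover have "induced_map KE W i (U +>\<^bsub>L\<^esub> x) = W +>\<^bsub>E\<^esub> i x" if "x \<in> a_kernel L L (A ^^ k)" for x
    using induced_map_coset[OF KLm KEm iK Usub Wsub iU, of x] that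
    by (simp add: KL_def KE_def a_r_coset_def')
  ultimately show ?thesis
    unfolding gen_homology_def KL_def KE_def U_def W_def by blast
qed

section \<open>Filtrations shifted by a differential\<close>

text \<open>The hypotheses \<open>Q_reflects\<close> and \<open>Q_covers\<close> are the injectivity and the surjectivity of the
  map induced by \<open>Q\<close> between consecutive quotients of the filtration. Injectivity fails at the top,
  where \<open>Q\<close> has nowhere to go (hence \<open>Suc j < h\<close>), and surjectivity fails at the bottom,
  where nothing precedes (hence \<open>0 < j\<close>).\<close>

locale shifted_filtration = module complex_field E
  for E :: "(complex, 'a) module" (structure) +
  fixes Q :: "'a \<Rightarrow> 'a" and F :: "nat \<Rightarrow> 'a set" and h :: nat
  assumes h_pos: "0 < h"
    and Q_hom: "Q \<in> module_hom complex_field E E"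
    and F_submodule: "submodule (F j) complex_field E"
    and F_Suc: "F j \<subseteq> F (Suc j)"
    and F_top: "F h = carrier E"
    and Q_F_zero: "x \<in> F 0 \<Longrightarrow> Q x \<in> F 0"
    and Q_F: "x \<in> F j \<Longrightarrow> Q x \<in> F (Suc j)"
    and Q_reflects: "\<lbrakk>Suc j < h; x \<in> F (Suc j); Q x \<in> F (Suc j)\<rbrakk> \<Longrightarrow> x \<in> F j"
    and Q_covers: "\<lbrakk>0 < j; j < h; x \<in> F (Suc j)\<rbrakk> \<Longrightarrow> \<exists>y\<in>F j. \<exists>z\<in>F j. x = Q y \<oplus> z"
begin

lemmas Q_pow = module_homD[OF module_hom_funpow[OF Q_hom]]

lemma F_mono: "i \<le> j \<Longrightarrow> F i \<subseteq> F j"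
  by (rule lift_Suc_mono_le[of F]) (rule F_Suc)

lemma F_carrier: "x \<in> F j \<Longrightarrow> x \<in> carrier E"
  using submoduleE(1)[OF F_submodule] by blast

lemma Q_pow_F: "x \<in> F j \<Longrightarrow> (Q ^^ m) x \<in> F (j + m)"
  by (induction m) (auto intro: Q_F)

text \<open>Descent along the filtration: as \<open>Q x\<close> lies in every step, \<open>Q_reflects\<close> applies repeatedly.\<close>

lemma in_F_zero_if_Q: "\<lbrakk>x \<in> F j; j < h; Q x \<in> F 0\<rbrakk> \<Longrightarrow> x \<in> F 0"
proof (induction j)
  case (Suc j)
  have "Q x \<in> F (Suc j)" using Suc.prems(3) F_mono[of 0 "Suc j"] by blast
  then have "x \<in> F j" using Suc.prems Q_reflects by blast
  then show ?case using Suc by simp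
qed

text \<open>The bound \<open>j + m \<le> h\<close> ensures that no leading component of \<open>x\<close> is pushed past the top of
  the filtration by \<open>m\<close> applications of \<open>Q\<close>.\<close>

lemma in_F_zero_if_Q_pow: "\<lbrakk>x \<in> F j; j + m \<le> h; (Q ^^ m) x \<in> F 0\<rbrakk> \<Longrightarrow> x \<in> F 0"
proof (induction m)
  case (Suc m)
  have "(Q ^^ m) x \<in> F 0"
    using in_F_zero_if_Q[of "(Q ^^ m) x" "j + m"] Q_pow_F[OF Suc.prems(1)] Suc.prems by simp
  then show ?case using Suc by simp
qed simp

text \<open>By \<open>Q_covers\<close>, an element is congruent to a value of \<open>Q\<close> modulo the next smaller step. The
  process stops at \<open>F 1\<close>, which plays the part of the generators of \<open>E\<close> under \<open>Q\<close>.\<close>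

lemma Q_quotient_remainder:
  assumes "x \<in> carrier E"
  shows "\<exists>u\<in>carrier E. \<exists>r\<in>F 1. x = Q u \<oplus> r"
proof -
  have "\<exists>u\<in>carrier E. \<exists>r\<in>F 1. x = Q u \<oplus> r" if "x \<in> F (Suc j)" "j < h" for x j
    using that
  proof (induction j arbitrary: x)
    case 0
    have "Q \<zero> = \<zero>" using module_hom_zero[OF module_axioms module_axioms Q_hom] .
    then show ?case using 0 F_carrier by (intro bexI[of _ \<zero>] bexI[of _ x]) auto
  next
    case (Suc j)
    obtain y z where yz: "y \<in> F (Suc j)" "z \<in> F (Suc j)" "x = Q y \<oplus> z"
      using Q_covers[of "Suc j" x] Suc.prems by auto
    obtain u r where ur: "u \<in> carrier E" "r \<in> F 1" "z = Q u \<oplus> r"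
      using Suc.IH[OF yz(2)] Suc.prems by auto
    have "x = Q (y \<oplus> u) \<oplus> r"
      using yz ur F_carrier module_homD[OF Q_hom] by (simp add: M.a_assoc)
    then show ?case using yz ur F_carrier by blast
  qed
  from this[of x "h - 1"] show ?thesis
    using assms h_pos F_top by simp
qed

text \<open>Dividing the quotient by \<open>Q\<close> once more creates a new remainder \<open>Q\<^sup>m s\<close> with \<open>s \<in> F 1\<close>, which
  lies in \<open>F (m + 1)\<close>.\<close>

lemma Q_pow_quotient_remainder:
  assumes "x \<in> carrier E"
  shows "\<exists>u\<in>carrier E. \<exists>r\<in>F m. x = (Q ^^ m) u \<oplus> r"
proof (induction m)
  case 0
  have "\<zero> \<in> F 0" using subgroup.one_closed[OF submodule.axioms(1)[OF F_submodule]] by simp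
  then show ?case using assms by (intro bexI[of _ x] bexI[of _ \<zero>]) auto
next
  case (Suc m)
  then obtain u r where ur: "u \<in> carrier E" "r \<in> F m" "x = (Q ^^ m) u \<oplus> r" by blast
  obtain v s where vs: "v \<in> carrier E" "s \<in> F 1" "u = Q v \<oplus> s"
    using Q_quotient_remainder[OF ur(1)] by blast
  have s': "(Q ^^ m) s \<in> F (Suc m)" using Q_pow_F[OF vs(2), of m] by simp
  have "x = (Q ^^ Suc m) v \<oplus> ((Q ^^ m) s \<oplus> r)"
    using ur vs F_carrier Q_pow module_homD(1)[OF Q_hom]
    by (simp add: M.a_assoc funpow_swap1)
  moreover have "(Q ^^ m) s \<oplus> r \<in> F (Suc m)"
    using s' ur(2) F_Suc submoduleE(5)[OF F_submodule] by blast
  ultimately show ?case using vs(1) by blast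
qed

text \<open>The subspace \<open>F 1\<close> generates \<open>E\<close> under \<open>Q\<close>, and the kernel of \<open>Q\<^sup>m\<close> is stable under \<open>Q\<close>.\<close>

lemma Q_pow_eq_zero_if_on_F_one:
  assumes "\<And>x. x \<in> F 1 \<Longrightarrow> (Q ^^ m) x = \<zero>" and "x \<in> carrier E"
  shows "(Q ^^ m) x = \<zero>"
proof -
  have "(Q ^^ m) x = \<zero>" if "x \<in> F (Suc j)" "j < h" for x j
    using that
  proof (induction j arbitrary: x)
    case 0
    then show ?case using assms(1) by simp
  next
    case (Suc j)
    obtain y z where yz: "y \<in> F (Suc j)" "z \<in> F (Suc j)" "x = Q y \<oplus> z"
      using Q_covers[of "Suc j" x] Suc.prems by auto
    have "(Q ^^ m) (Q y) = Q ((Q ^^ m) y)" by (rule funpow_swap1[symmetric])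
    also have "\<dots> = \<zero>"
      using Suc yz module_hom_zero[OF module_axioms module_axioms Q_hom] by simp
    finally show ?case
      using Suc yz F_carrier Q_pow(2)[of "Q y" z] module_homD(1)[OF Q_hom] by simp
  qed
  from this[of x "h - 1"] show ?thesis
    using assms h_pos F_top by simp
qed

text \<open>Both the injectivity and the surjectivity combine division with remainder and detection of
  \<open>F 0\<close>, with the complementary exponents \<open>k\<close> and \<open>h - k\<close> exchanged.\<close>

theorem gen_homology_F_zero_iso:
  fixes L :: "(complex, 'b) module"
  assumes L: "differential_space h L A"
    and Qh: "\<And>x. x \<in> carrier E \<Longrightarrow> (Q ^^ h) x = \<zero>"
    and i: "i \<in> module_hom complex_field L E" "bij_betw i (carrier L) (F 0)"
    and comm: "\<And>x. x \<in> carrier L \<Longrightarrow> i (A x) = Q (i x)"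
    and k: "k \<le> h"
  shows "\<exists>\<phi>\<in>module_iso complex_field (gen_homology h k L A) (gen_homology h k E Q).
    \<forall>x\<in>a_kernel L L (A ^^ k).
      \<phi> ((A ^^ (h - k)) ` carrier L +>\<^bsub>L\<^esub> x) = (Q ^^ (h - k)) ` carrier E +> i x"
proof (rule gen_homology_iso[OF L _ i(1) comm k])
  show "differential_space h E Q"
    using Qh Q_hom module_axioms by (simp add: differential_space_def)
  have Lm: "module complex_field L" and A: "A \<in> module_hom complex_field L L"
    using L by (auto simp: differential_space_def)
  interpret L: module complex_field L by (rule Lm)
  note A_pow = module_homD[OF module_hom_funpow[OF A]]
  have pow_comm: "i ((A ^^ n) x) = (Q ^^ n) (i x)" if "x \<in> carrier L" for n x
    by (induction n) (use that A_pow comm in auto)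
  have inj_i: "inj_on i (carrier L)" and im_i: "i ` carrier L = F 0"
    using i(2) by (auto simp: bij_betw_def)
  have zero_F: "\<zero> \<in> F j" for j
    using subgroup.one_closed[OF submodule.axioms(1)[OF F_submodule]] by simp
  have Q_pow_split: "(Q ^^ m) ((Q ^^ (h - m)) v) = \<zero>" if "m \<le> h" "v \<in> carrier E" for m v
    using Qh[OF that(2)] that(1) by (metis funpow_add comp_apply le_add_diff_inverse)
  show "x \<in> (A ^^ (h - k)) ` carrier L"
    if x: "x \<in> carrier L" and u: "u \<in> carrier E" "i x = (Q ^^ (h - k)) u" for x u
  proof -
    obtain v r where vr: "v \<in> carrier E" "r \<in> F k" "u = (Q ^^ k) v \<oplus> r"
      using Q_pow_quotient_remainder[OF u(1)] by blast
    have ix: "i x = (Q ^^ (h - k)) r"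
      using u vr F_carrier Q_pow Q_pow_split[of "h - k" v] k by simp
    have "r \<in> F 0"
      by (rule in_F_zero_if_Q_pow[OF vr(2), of "h - k"]) (use k imageI[OF x, of i] im_i ix in auto)
    then obtain y where y: "y \<in> carrier L" "r = i y" using im_i by auto
    then have "i x = i ((A ^^ (h - k)) y)" using ix pow_comm by simp
    then show ?thesis using inj_onD[OF inj_i] x y A_pow(1) by blast
  qed
  show "\<exists>u\<in>carrier E. \<exists>x\<in>carrier L. (A ^^ k) x = \<zero>\<^bsub>L\<^esub> \<and> y = (Q ^^ (h - k)) u \<oplus> i x"
    if y: "y \<in> carrier E" "(Q ^^ k) y = \<zero>" for y
  proof -
    obtain u r where ur: "u \<in> carrier E" "r \<in> F (h - k)" "y = (Q ^^ (h - k)) u \<oplus> r"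
      using Q_pow_quotient_remainder[OF y(1)] by blast
    have Qr: "(Q ^^ k) r = \<zero>"
      using y ur F_carrier Q_pow Q_pow_split[OF k, of u] by simp
    have "r \<in> F 0"
      by (rule in_F_zero_if_Q_pow[OF ur(2), of k]) (use k Qr zero_F in auto)
    then obtain x where x: "x \<in> carrier L" "r = i x" using im_i by auto
    have "i ((A ^^ k) x) = i \<zero>\<^bsub>L\<^esub>"
      using x Qr pow_comm module_hom_zero[OF Lm module_axioms i(1)] by simp
    then have "(A ^^ k) x = \<zero>\<^bsub>L\<^esub>" using inj_onD[OF inj_i] x A_pow(1) by blast
    then show ?thesis using ur x by blast
  qed
qed

end

section \<open>Gaussian binomial coefficients at roots of unity\<close>

text \<open>The recursion is the \<open>q\<close>-Pascal rule that the components of powers of \<open>d + A\<close> satisfy when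
  \<open>A d = \<zeta> d A\<close>. The coefficients are defined by it instead of by a quotient of products, as the
  denominators vanish at roots of unity.\<close>

fun gauss_binomial :: "'a::comm_ring_1 \<Rightarrow> nat \<Rightarrow> nat \<Rightarrow> 'a" where
  "gauss_binomial \<zeta> m 0 = 1"
| "gauss_binomial \<zeta> 0 (Suc n) = 0"
| "gauss_binomial \<zeta> (Suc m) (Suc n) =
    gauss_binomial \<zeta> m n + \<zeta> ^ Suc n * gauss_binomial \<zeta> m (Suc n)"

lemma gauss_binomial_eq_0: "m < n \<Longrightarrow> gauss_binomial \<zeta> m n = 0"
  by (induction \<zeta> m n rule: gauss_binomial.induct) auto

text \<open>This is the ratio of two neighbouring coefficients in the product formula, cleared of
  denominators. The truncated subtraction does no harm: for \<open>m < n\<close> both sides vanish. The induction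
  first yields the absorption rule for \<open>Suc m\<close>, and then compares it with the Pascal rule for
  \<open>gauss_binomial \<zeta> (Suc m) n\<close>.\<close>

lemma gauss_binomial_Suc_right:
  "(1 - \<zeta> ^ Suc n) * gauss_binomial \<zeta> m (Suc n) = (1 - \<zeta> ^ (m - n)) * gauss_binomial \<zeta> m n"
proof (induction m arbitrary: n)
  case 0
  show ?case by (cases n) auto
next
  case (Suc m)
  have absorb: "(1 - \<zeta> ^ Suc n) * gauss_binomial \<zeta> (Suc m) (Suc n) =
      (1 - \<zeta> ^ Suc m) * gauss_binomial \<zeta> m n" for n
  proof (cases "n \<le> m")
    case True
    have "(1 - \<zeta> ^ Suc n) * gauss_binomial \<zeta> (Suc m) (Suc n) =
      (1 - \<zeta> ^ Suc n) * gauss_binomial \<zeta> m n +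
        \<zeta> ^ Suc n * ((1 - \<zeta> ^ Suc n) * gauss_binomial \<zeta> m (Suc n))"
      by (simp add: algebra_simps)
    also have "\<dots> = (1 - \<zeta> ^ (Suc n + (m - n))) * gauss_binomial \<zeta> m n"
      unfolding Suc.IH power_add by (simp add: algebra_simps)
    finally show ?thesis using True by simp
  qed (simp add: gauss_binomial_eq_0)
  show ?case
  proof (cases n)
    case 0
    then show ?thesis using absorb[of 0] by simp
  next
    case n: (Suc l)
    show ?thesis
    proof (cases "n \<le> m")
      case True
      have "(1 - \<zeta> ^ (Suc m - n)) * gauss_binomial \<zeta> (Suc m) n =
        (1 - \<zeta> ^ (m - l)) * gauss_binomial \<zeta> m l +
          (\<zeta> ^ n - \<zeta> ^ n * \<zeta> ^ (Suc m - n)) * gauss_binomial \<zeta> m n"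
        using n by (simp add: algebra_simps)
      also have "(1 - \<zeta> ^ (m - l)) * gauss_binomial \<zeta> m l = (1 - \<zeta> ^ n) * gauss_binomial \<zeta> m n"
        unfolding n by (rule Suc.IH[symmetric])
      also have "\<zeta> ^ n * \<zeta> ^ (Suc m - n) = \<zeta> ^ Suc m"
        using True by (simp flip: power_add)
      also have "(1 - \<zeta> ^ n) * gauss_binomial \<zeta> m n + (\<zeta> ^ n - \<zeta> ^ Suc m) * gauss_binomial \<zeta> m n =
          (1 - \<zeta> ^ Suc m) * gauss_binomial \<zeta> m n"
        by (simp add: left_diff_distrib)
      finally show ?thesis using absorb[of n] by simp
    next
      case False
      then show ?thesis using absorb[of n] by (cases "n = Suc m") (simp_all add: gauss_binomial_eq_0)
    qed
  qed
qed

text \<open>The vanishing starts at \<open>n = 1\<close>, where the factor \<open>1 - \<zeta> ^ h\<close> is zero, and spreads to larger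
  \<open>n\<close> because \<open>1 - \<zeta> ^ n\<close> can be cancelled.\<close>

lemma gauss_binomial_root_of_unity:
  fixes \<zeta> :: "'a::idom"
  assumes "\<zeta> ^ h = 1" "0 < n" "n < h" "\<And>j. \<lbrakk>0 < j; j < h\<rbrakk> \<Longrightarrow> \<zeta> ^ j \<noteq> 1"
  shows "gauss_binomial \<zeta> h n = 0"
  using assms(2,3)
proof (induction n)
  case (Suc n)
  have "(1 - \<zeta> ^ (h - n)) * gauss_binomial \<zeta> h n = 0"
    using Suc assms(1) by (cases n) auto
  then have "(1 - \<zeta> ^ Suc n) * gauss_binomial \<zeta> h (Suc n) = 0"
    by (simp only: gauss_binomial_Suc_right)
  then show ?case using assms(4)[of "Suc n"] Suc.prems by simp
qed simp

section \<open>The graded space and its filtration\<close>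

lemma carrier_complex_field [simp]: "carrier complex_field = UNIV"
  and one_complex_field [simp]: "\<one>\<^bsub>complex_field\<^esub> = 1"
  and zero_complex_field [simp]: "\<zero>\<^bsub>complex_field\<^esub> = 0"
  and add_complex_field [simp]: "a \<oplus>\<^bsub>complex_field\<^esub> b = a + b"
  and mult_complex_field [simp]: "a \<otimes>\<^bsub>complex_field\<^esub> b = a * b"
  by (simp_all add: complex_field_def)

text \<open>The construction of the graded space and of \<open>Q\<close> for an arbitrary scalar \<open>q\<close>. The
  relation \<open>A\<^sup>h = 0\<close> and the condition that \<open>q\<^sup>2\<close> is a primitive root of unity are hypotheses of
  \<open>Q_pow_h_eq_zero\<close>, where they together yield \<open>Q\<^sup>h = 0\<close>.\<close>

locale graded_extension = module complex_field H
  for H :: "(complex, 'a) module" (structure) +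
  fixes W :: "'a set" and A :: "'a \<Rightarrow> 'a" and h :: nat and q :: complex
  assumes h_pos: "0 < h"
    and A_hom: "A \<in> module_hom complex_field H H"
    and W_submodule: "submodule W complex_field H"
    and A_W: "A ` W \<subseteq> W"
begin

abbreviation V where "V \<equiv> quot_module H W"
abbreviation E where "E \<equiv> graded_space h H W"
abbreviation Q where "Q \<equiv> graded_Q h q H W A"
abbreviation incl where "incl \<equiv> graded_incl h H W"

sublocale V: module complex_field V
  by (rule module_quot_module[OF module_axioms W_submodule])

lemmas A_simps = module_homD[OF A_hom]
lemmas A_pow_simps = module_homD[OF module_hom_funpow[OF A_hom]]
lemmas V_carrier = quot_module_carrier[OF module_axioms W_submodule]
lemmas V_zero = quot_module_zero[OF module_axioms W_submodule]
lemmas V_add = quot_module_add[OF module_axioms W_submodule]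
lemmas V_smult = quot_module_smult[OF module_axioms W_submodule, simplified]

lemma coset_in_V: "x \<in> carrier H \<Longrightarrow> W +> x \<in> carrier V"
  by (simp add: V_carrier)

lemma coset_zero: "W +> \<zero> = W"
  using submoduleE(1)[OF W_submodule] by simp

lemma W_in_V: "W \<in> carrier V"
  using coset_in_V[of \<zero>] coset_zero by simp

lemma induced_A_coset: "x \<in> carrier H \<Longrightarrow> induced_map H W A (W +> x) = W +> A x"
  by (rule induced_map_coset[OF module_axioms module_axioms A_hom W_submodule W_submodule A_W])

lemma induced_A_hom: "induced_map H W A \<in> module_hom complex_field V V"
  by (rule induced_map_module_hom[OF module_axioms module_axioms A_hom W_submodule W_submodule A_W])

lemmas induced_A_simps = module_homD[OF induced_A_hom]

lemma induced_A_W: "induced_map H W A W = W"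
  using module_hom_zero[OF V.module_axioms V.module_axioms induced_A_hom] by (simp add: V_zero)

lemma graded_carrier:
  "v \<in> carrier E \<longleftrightarrow> fst v \<in> carrier H \<and> snd v \<in> (\<Pi>\<^sub>E n \<in> {1..<h}. carrier V)"
  by (cases v) (simp add: graded_space_def)

lemma graded_snd: "\<lbrakk>v \<in> carrier E; n \<in> {1..<h}\<rbrakk> \<Longrightarrow> snd v n \<in> carrier V"
  by (auto simp: graded_carrier)

lemma graded_add:
  "v \<oplus>\<^bsub>E\<^esub> w = (fst v \<oplus> fst w, \<lambda>n \<in> {1..<h}. snd v n \<oplus>\<^bsub>V\<^esub> snd w n)"
  by (simp add: graded_space_def case_prod_beta)

lemma graded_smult: "c \<odot>\<^bsub>E\<^esub> v = (c \<odot> fst v, \<lambda>n \<in> {1..<h}. c \<odot>\<^bsub>V\<^esub> snd v n)"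
  by (simp add: graded_space_def case_prod_beta)

lemma graded_zero: "\<zero>\<^bsub>E\<^esub> = (\<zero>, \<lambda>n \<in> {1..<h}. \<zero>\<^bsub>V\<^esub>)"
  by (simp add: graded_space_def)

lemma graded_sel:
  "fst (v \<oplus>\<^bsub>E\<^esub> w) = fst v \<oplus> fst w"
  "fst (c \<odot>\<^bsub>E\<^esub> v) = c \<odot> fst v"
  "fst \<zero>\<^bsub>E\<^esub> = \<zero>"
  "n \<in> {1..<h} \<Longrightarrow> snd (v \<oplus>\<^bsub>E\<^esub> w) n = snd v n \<oplus>\<^bsub>V\<^esub> snd w n"
  "n \<in> {1..<h} \<Longrightarrow> snd (c \<odot>\<^bsub>E\<^esub> v) n = c \<odot>\<^bsub>V\<^esub> snd v n"
  "n \<in> {1..<h} \<Longrightarrow> snd \<zero>\<^bsub>E\<^esub> n = \<zero>\<^bsub>V\<^esub>"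
  by (simp_all add: graded_add graded_smult graded_zero)

lemma graded_eqI:
  assumes "v \<in> carrier E" "w \<in> carrier E" "fst v = fst w"
    and "\<And>n. n \<in> {1..<h} \<Longrightarrow> snd v n = snd w n"
  shows "v = w"
proof (rule prod_eqI)
  show "snd v = snd w"
    by (rule PiE_ext[of _ "{1..<h}" "\<lambda>_. carrier V"]) (use assms in \<open>auto simp: graded_carrier\<close>)
qed (rule assms(3))

lemma graded_add_closed: "\<lbrakk>v \<in> carrier E; w \<in> carrier E\<rbrakk> \<Longrightarrow> v \<oplus>\<^bsub>E\<^esub> w \<in> carrier E"
  using graded_snd by (simp add: graded_carrier[of "v \<oplus>\<^bsub>E\<^esub> w"] graded_add) (simp add: graded_carrier)

lemma graded_smult_closed: "v \<in> carrier E \<Longrightarrow> c \<odot>\<^bsub>E\<^esub> v \<in> carrier E"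
  using graded_snd by (simp add: graded_carrier[of "c \<odot>\<^bsub>E\<^esub> v"] graded_smult) (simp add: graded_carrier)

lemma graded_zero_closed: "\<zero>\<^bsub>E\<^esub> \<in> carrier E"
  by (simp add: graded_carrier graded_zero)

lemma module_graded_space: "module complex_field E"
proof -
  have fstE: "fst v \<in> carrier H" if "v \<in> carrier E" for v
    using that by (simp add: graded_carrier)
  note closed = graded_add_closed graded_smult_closed graded_zero_closed
  have "abelian_group E"
  proof (rule abelian_groupI)
    fix u v w assume u: "u \<in> carrier E" and v: "v \<in> carrier E" and w: "w \<in> carrier E"
    show "u \<oplus>\<^bsub>E\<^esub> v \<oplus>\<^bsub>E\<^esub> w = u \<oplus>\<^bsub>E\<^esub> (v \<oplus>\<^bsub>E\<^esub> w)"
      by (rule graded_eqI)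
        (simp_all add: graded_sel graded_snd fstE closed u v w M.a_assoc V.M.a_assoc)
  next
    fix u v assume u: "u \<in> carrier E" and v: "v \<in> carrier E"
    show "u \<oplus>\<^bsub>E\<^esub> v \<in> carrier E" by (rule closed(1)[OF u v])
    show "u \<oplus>\<^bsub>E\<^esub> v = v \<oplus>\<^bsub>E\<^esub> u"
      by (rule graded_eqI)
        (simp_all add: graded_sel graded_snd fstE closed u v M.a_comm V.M.a_comm)
  next
    fix u assume u: "u \<in> carrier E"
    show "\<zero>\<^bsub>E\<^esub> \<oplus>\<^bsub>E\<^esub> u = u"
      by (rule graded_eqI) (simp_all add: graded_sel graded_snd fstE closed u)
    have "(\<ominus> fst u, \<lambda>n \<in> {1..<h}. \<ominus>\<^bsub>V\<^esub> snd u n) \<in> carrier E" (is "?w \<in> _")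
      using fstE[OF u] graded_snd[OF u] by (simp add: graded_carrier)
    moreover from this have "?w \<oplus>\<^bsub>E\<^esub> u = \<zero>\<^bsub>E\<^esub>"
      by (intro graded_eqI)
        (simp_all add: graded_sel graded_snd fstE closed u M.l_neg V.M.l_neg)
    ultimately show "\<exists>w\<in>carrier E. w \<oplus>\<^bsub>E\<^esub> u = \<zero>\<^bsub>E\<^esub>" by blast
  qed (rule closed(3))
  then show ?thesis
  proof (rule moduleI[OF R.is_cring])
    fix a b u v
    assume u: "u \<in> carrier E" and v: "v \<in> carrier E"
    show "a \<odot>\<^bsub>E\<^esub> u \<in> carrier E" by (rule closed(2)[OF u])
    show "(a \<oplus>\<^bsub>complex_field\<^esub> b) \<odot>\<^bsub>E\<^esub> u = a \<odot>\<^bsub>E\<^esub> u \<oplus>\<^bsub>E\<^esub> b \<odot>\<^bsub>E\<^esub> u"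
      by (rule graded_eqI)
        (use smult_l_distr[of a b] V.smult_l_distr[of a b] in
          \<open>simp_all add: graded_sel graded_snd fstE closed u\<close>)
    show "a \<odot>\<^bsub>E\<^esub> (u \<oplus>\<^bsub>E\<^esub> v) = a \<odot>\<^bsub>E\<^esub> u \<oplus>\<^bsub>E\<^esub> a \<odot>\<^bsub>E\<^esub> v"
      by (rule graded_eqI)
        (simp_all add: graded_sel graded_snd fstE closed u v smult_r_distr V.smult_r_distr)
    show "(a \<otimes>\<^bsub>complex_field\<^esub> b) \<odot>\<^bsub>E\<^esub> u = a \<odot>\<^bsub>E\<^esub> (b \<odot>\<^bsub>E\<^esub> u)"
      by (rule graded_eqI)
        (use smult_assoc1[of a b] V.smult_assoc1[of a b] in
          \<open>simp_all add: graded_sel graded_snd fstE closed u\<close>)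
    show "\<one>\<^bsub>complex_field\<^esub> \<odot>\<^bsub>E\<^esub> u = u"
      by (rule graded_eqI)
        (use smult_one V.smult_one in
          \<open>simp_all add: graded_sel graded_snd fstE closed u\<close>)
  qed
qed

sublocale E: module complex_field E
  by (rule module_graded_space)

text \<open>The component of degree 0 is taken modulo \<open>W\<close>, so that all components live in the same space
  \<open>V\<close>. These are the components of an element of the quotient of \<open>E\<close> by \<open>W\<close>.\<close>

definition component :: "nat \<Rightarrow> 'a \<times> (nat \<Rightarrow> 'a set) \<Rightarrow> 'a set"
  where "component n v = (if n = 0 then W +> fst v else snd v n)"

lemma component_hom: "n < h \<Longrightarrow> component n \<in> module_hom complex_field E V"
  using graded_snd
  by (intro module_homI)
    (auto simp: component_def graded_add graded_smult coset_in_V V_add V_smult graded_carrier)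

lemmas component_simps = module_homD[OF component_hom]

lemma Q_fst: "v \<in> carrier E \<Longrightarrow> fst (Q v) = A (fst v)"
  by (simp add: graded_Q_def graded_add graded_d_def graded_A_def case_prod_beta graded_carrier A_simps)

lemma Q_closed:
  assumes v: "v \<in> carrier E"
  shows "Q v \<in> carrier E"
proof -
  have "snd v (n - 1) \<in> carrier V" if "n \<in> {1..<h}" "n \<noteq> 1" for n
    by (rule graded_snd[OF v]) (use that in auto)
  then have "graded_d h H W v \<in> carrier E"
    using v by (auto simp: graded_carrier graded_d_def case_prod_beta coset_in_V)
  moreover have "graded_A h q H W A v \<in> carrier E"
    using v graded_snd[OF v] induced_A_simps(1)
    by (auto simp: graded_carrier graded_A_def case_prod_beta A_simps)
  ultimately show ?thesis
    unfolding graded_Q_def by (rule graded_add_closed)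
qed

lemma component_Q:
  assumes "v \<in> carrier E" "Suc n < h"
  shows "component (Suc n) (Q v) = component n v \<oplus>\<^bsub>V\<^esub>
    q ^ (2 * Suc n) \<odot>\<^bsub>V\<^esub> induced_map H W A (component (Suc n) v)"
  using assms(2)
  by (simp add: component_def graded_Q_def graded_add graded_d_def graded_A_def case_prod_beta)

lemma component_zero_Q:
  assumes "v \<in> carrier E"
  shows "component 0 (Q v) = induced_map H W A (component 0 v)"
  using assms by (simp add: component_def Q_fst induced_A_coset graded_carrier)

text \<open>In degree 0 the \<open>component\<close> forgets the part in \<open>W\<close>, so there the first coordinates
  themselves have to be compared.\<close>

lemma graded_eq_componentI:
  assumes "v \<in> carrier E" "w \<in> carrier E" "fst v = fst w"
    and "\<And>n. Suc n < h \<Longrightarrow> component (Suc n) v = component (Suc n) w"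
  shows "v = w"
proof (rule graded_eqI[OF assms(1-3)])
  fix n assume "n \<in> {1..<h}"
  then show "snd v n = snd w n"
    using assms(4)[of "n - 1"] by (simp add: component_def)
qed

lemma Q_hom: "Q \<in> module_hom complex_field E E"
proof (rule module_homI)
  fix v w assume v: "v \<in> carrier E" and w: "w \<in> carrier E"
  show "Q v \<in> carrier E" by (rule Q_closed[OF v])
  have fstvw: "fst v \<in> carrier H" "fst w \<in> carrier H" using v w by (auto simp: graded_carrier)
  show "Q (v \<oplus>\<^bsub>E\<^esub> w) = Q v \<oplus>\<^bsub>E\<^esub> Q w"
  proof (rule graded_eq_componentI)
    show "fst (Q (v \<oplus>\<^bsub>E\<^esub> w)) = fst (Q v \<oplus>\<^bsub>E\<^esub> Q w)"
      using v w fstvw A_simps by (simp add: Q_fst) (simp add: graded_add Q_fst)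
    fix n assume n: "Suc n < h"
    show "component (Suc n) (Q (v \<oplus>\<^bsub>E\<^esub> w)) = component (Suc n) (Q v \<oplus>\<^bsub>E\<^esub> Q w)"
      using n v w component_simps[of n] component_simps[of "Suc n"]
      by (simp add: component_Q Q_closed induced_A_simps V.smult_r_distr V.M.a_ac)
  qed (use v w Q_closed in auto)
  fix c
  show "Q (c \<odot>\<^bsub>E\<^esub> v) = c \<odot>\<^bsub>E\<^esub> Q v"
  proof (rule graded_eq_componentI)
    show "fst (Q (c \<odot>\<^bsub>E\<^esub> v)) = fst (c \<odot>\<^bsub>E\<^esub> Q v)"
      using v fstvw A_simps by (simp add: Q_fst) (simp add: graded_smult Q_fst)
    fix n assume n: "Suc n < h"
    let ?B = "induced_map H W A (component (Suc n) v)" and ?r = "q ^ (2 * Suc n)"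
    have B: "?B \<in> carrier V" using n v by (intro induced_A_simps component_simps)
    have "?r \<odot>\<^bsub>V\<^esub> (c \<odot>\<^bsub>V\<^esub> ?B) = c \<odot>\<^bsub>V\<^esub> (?r \<odot>\<^bsub>V\<^esub> ?B)"
      using V.smult_assoc1[of ?r c ?B] V.smult_assoc1[of c ?r ?B] B by (simp add: mult.commute)
    then show "component (Suc n) (Q (c \<odot>\<^bsub>E\<^esub> v)) = component (Suc n) (c \<odot>\<^bsub>E\<^esub> Q v)"
      using n v B component_simps[of n] component_simps[of "Suc n"]
      by (simp add: component_Q Q_closed induced_A_simps V.smult_r_distr del: power_Suc)
  qed (use v Q_closed in auto)
qed

lemmas Q_pow = module_homD[OF module_hom_funpow[OF Q_hom]]

definition filt :: "nat \<Rightarrow> ('a \<times> (nat \<Rightarrow> 'a set)) set"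
  where "filt j = {v \<in> carrier E. \<forall>n. j \<le> n \<and> n < h \<longrightarrow> component n v = W}"

lemma filt_submodule: "submodule (filt j) complex_field E"
proof (rule E.submoduleI)
  note zero = module_hom_zero[OF E.module_axioms V.module_axioms component_hom, unfolded V_zero]
  have W_plus: "W \<oplus>\<^bsub>V\<^esub> W = W" and W_smult: "c \<odot>\<^bsub>V\<^esub> W = W" for c
    using V.M.l_zero[of W] W_in_V V.smult_r_null[of c] by (simp_all add: V_zero)
  have minus: "component n (\<ominus>\<^bsub>E\<^esub> v) = W" if "v \<in> carrier E" "n < h" "component n v = W" for n v
    using that module_hom_minus[OF E.module_axioms V.module_axioms component_hom, of n "\<zero>\<^bsub>E\<^esub>" v]
      zero[of n] V.M.r_neg[OF W_in_V]
    by (simp add: E.M.minus_eq V.M.minus_eq V_zero)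
  show "filt j \<subseteq> carrier E" "\<zero>\<^bsub>E\<^esub> \<in> filt j"
    using zero by (auto simp: filt_def)
  show "\<ominus>\<^bsub>E\<^esub> v \<in> filt j" if "v \<in> filt j" for v
    using that minus by (auto simp: filt_def)
  show "v \<oplus>\<^bsub>E\<^esub> w \<in> filt j" if "v \<in> filt j" "w \<in> filt j" for v w
    using that component_simps(2) W_plus by (auto simp: filt_def)
  show "c \<odot>\<^bsub>E\<^esub> v \<in> filt j" if "v \<in> filt j" for c v
    using that component_simps(3) W_smult by (auto simp: filt_def)
qed

lemma V_add_smult_induced_W: "X \<in> carrier V \<Longrightarrow> X \<oplus>\<^bsub>V\<^esub> c \<odot>\<^bsub>V\<^esub> induced_map H W A W = X"
  using V.smult_r_null[of c] V.M.r_zero[of X] by (simp add: induced_A_W V_zero)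

text \<open>On leading components, that is modulo lower filtration steps, \<open>Q\<close> is the shift
  \<open>d\<close>: the term coming from \<open>A\<close> keeps the degree and so does not contribute above the top degree.\<close>

lemma component_Q_top:
  assumes "v \<in> carrier E" "Suc n < h" "component (Suc n) v = W"
  shows "component (Suc n) (Q v) = component n v"
  using assms component_simps(1)[of n v] by (simp add: component_Q V_add_smult_induced_W)

definition homogeneous :: "nat \<Rightarrow> 'a \<Rightarrow> 'a \<times> (nat \<Rightarrow> 'a set)"
  where "homogeneous m x =
    (if m = 0 then x else \<zero>, \<lambda>n \<in> {1..<h}. if n = m then W +> x else W)"

lemma homogeneous_closed: "x \<in> carrier H \<Longrightarrow> homogeneous m x \<in> carrier E"
  by (auto simp: homogeneous_def graded_carrier coset_in_V W_in_V)

lemma homogeneous_fst: "fst (homogeneous 0 x) = x"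
  by (simp add: homogeneous_def)

lemma component_homogeneous:
  "n < h \<Longrightarrow> component n (homogeneous m x) = (if n = m then W +> x else W)"
  by (simp add: component_def homogeneous_def coset_zero)

lemma filt_if_component:
  assumes "v \<in> filt (Suc j)" "component j v = W"
  shows "v \<in> filt j"
proof -
  have "component n v = W" if "j \<le> n" "n < h" for n
    using assms that by (cases "n = j") (auto simp: filt_def)
  then show ?thesis using assms(1) by (simp add: filt_def)
qed

lemma filt_Q:
  assumes "v \<in> filt j"
  shows "Q v \<in> filt (Suc j)"
proof -
  have "component n (Q v) = W" if n: "Suc j \<le> n" "n < h" for n
    using assms n component_Q_top[of v "n - 1"] by (cases n) (auto simp: filt_def)
  then show ?thesis using assms by (auto simp: filt_def Q_closed)
qed

sublocale filt: shifted_filtration E Q filt h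
proof (rule shifted_filtration.intro[OF module_graded_space], rule shifted_filtration_axioms.intro)
  show "0 < h" by (rule h_pos)
  show "Q \<in> module_hom complex_field E E" by (rule Q_hom)
  show "submodule (filt j) complex_field E" for j by (rule filt_submodule)
  show "filt j \<subseteq> filt (Suc j)" for j by (auto simp: filt_def)
  show "filt h = carrier E" by (auto simp: filt_def)
  show "Q v \<in> filt (Suc j)" if "v \<in> filt j" for v j using that by (rule filt_Q)
  show "Q v \<in> filt 0" if v: "v \<in> filt 0" for v
  proof -
    have "component 0 (Q v) = W"
      using v h_pos induced_A_W by (auto simp: filt_def component_zero_Q)
    then have "component n (Q v) = W" if "n < h" for n
      using filt_Q[OF v] that by (cases n) (auto simp: filt_def)
    moreover have "Q v \<in> carrier E" using v Q_closed by (auto simp: filt_def)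
    ultimately show ?thesis by (simp add: filt_def)
  qed
  show "v \<in> filt j" if j: "Suc j < h" and v: "v \<in> filt (Suc j)" "Q v \<in> filt (Suc j)" for j v
  proof -
    have "component j v = W"
      using j v component_Q_top[of v j] by (simp add: filt_def)
    then show ?thesis by (rule filt_if_component[OF v(1)])
  qed
  show "\<exists>y\<in>filt j. \<exists>z\<in>filt j. v = Q y \<oplus>\<^bsub>E\<^esub> z" if j: "0 < j" "j < h" and v: "v \<in> filt (Suc j)" for j v
  proof -
    have vE: "v \<in> carrier E" using v by (simp add: filt_def)
    obtain x where x: "x \<in> carrier H" "component j v = W +> x"
      using component_simps(1)[OF j(2) vE] by (auto simp: V_carrier)
    \<comment> \<open>A preimage under \<open>Q\<close> of the leading component of \<open>v\<close>: the same class, one degree lower.\<close>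
    define y where "y = homogeneous (j - 1) x"
    have y: "y \<in> filt j" using j x(1) by (auto simp: filt_def y_def homogeneous_closed component_homogeneous)
    have yE: "y \<in> carrier E" using y by (simp add: filt_def)
    have Qy: "Q y \<in> filt (Suc j)" by (rule filt_Q[OF y])
    define z where "z = v \<ominus>\<^bsub>E\<^esub> Q y"
    have zF: "z \<in> filt (Suc j)"
      using v Qy E.submoduleE(3,5)[OF filt_submodule] by (simp add: z_def E.M.minus_eq)
    have "j \<noteq> j - 1" using j by simp
    then have "component j (Q y) = W +> x"
      using component_Q_top[OF yE, of "j - 1"] j x
      by (simp add: y_def component_homogeneous)
    then have "component j z = W"
      using x module_hom_minus[OF E.module_axioms V.module_axioms component_hom[OF j(2)] vE Q_closed[OF yE]]
      by (simp add: z_def V.M.minus_eq V.M.r_neg coset_in_V V_zero)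
    then have "z \<in> filt j" by (rule filt_if_component[OF zF])
    moreover have "v = Q y \<oplus>\<^bsub>E\<^esub> z"
      using vE Q_closed[OF yE] by (simp add: z_def E.M.minus_eq E.M.r_neg1 E.M.a_lcomm E.M.r_neg)
    ultimately show ?thesis using y by blast
  qed
qed

lemma incl_eq_homogeneous: "x \<in> carrier H \<Longrightarrow> incl x = homogeneous 0 x"
  by (auto simp: graded_incl_def homogeneous_def V_zero fun_eq_iff)

text \<open>The \<open>q\<close>-binomial theorem for \<open>(d + A)\<^sup>m\<close>, read off in degree \<open>n\<close>. For \<open>m < n\<close>, where
  the exponent \<open>m - n\<close> is truncated, the coefficient is zero.\<close>

lemma component_Q_pow_incl:
  assumes x: "x \<in> carrier H" and n: "n < h"
  shows "component n ((Q ^^ m) (incl x)) =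
    W +> (gauss_binomial (q\<^sup>2) m n \<odot> (A ^^ (m - n)) x)"
  using n
proof (induction m arbitrary: n)
  case 0
  show ?case
  proof (cases n)
    case 0
    then show ?thesis using x h_pos smult_one[OF x]
      by (simp add: incl_eq_homogeneous component_homogeneous)
  next
    case (Suc l)
    then show ?thesis using 0 x smult_l_null[of x]
      by (simp add: incl_eq_homogeneous component_homogeneous coset_zero)
  qed
next
  case (Suc m)
  have vE: "(Q ^^ m) (incl x) \<in> carrier E"
    using x by (simp add: Q_pow incl_eq_homogeneous homogeneous_closed)
  show ?case
  proof (cases n)
    case 0
    then show ?thesis
      using Suc x vE A_pow_simps(1) smult_one A_simps(1)
      by (simp add: component_zero_Q induced_A_coset)
  next
    case n: (Suc l)
    let ?g = "gauss_binomial (q\<^sup>2)" and ?y = "(A ^^ (m - l)) x"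
    have y: "?y \<in> carrier H" using x A_pow_simps(1) by simp
    \<comment> \<open>For \<open>n \<le> m\<close> the exponents agree; for \<open>m < n\<close> the coefficient is zero.\<close>
    have shift: "?g m n \<odot> A ((A ^^ (m - n)) x) = ?g m n \<odot> ?y"
    proof (cases "n \<le> m")
      case True
      then have "m - l = Suc (m - n)" using n by simp
      then show ?thesis by simp
    next
      case False
      then show ?thesis
        using x y A_pow_simps(1) A_simps(1) smult_l_null by (simp add: gauss_binomial_eq_0)
    qed
    have "component n ((Q ^^ Suc m) (incl x)) =
      (W +> (?g m l \<odot> ?y)) \<oplus>\<^bsub>V\<^esub> q ^ (2 * n) \<odot>\<^bsub>V\<^esub> (W +> (?g m n \<odot> ?y))"
      using Suc.prems Suc.IH[of l] Suc.IH[of n] x vE component_Q[OF vE, of l] A_pow_simps(1) shift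
      by (simp add: n induced_A_coset A_simps)
    also have "\<dots> = W +> ((?g m l + (q\<^sup>2) ^ n * ?g m n) \<odot> ?y)"
      using y smult_l_distr[of "?g m l" "(q\<^sup>2) ^ n * ?g m n" ?y]
        smult_assoc1[of "(q\<^sup>2) ^ n" "?g m n" ?y]
      by (simp add: V_smult V_add power_mult)
    finally show ?thesis by (simp add: n)
  qed
qed

lemma Q_pow_fst: "v \<in> carrier E \<Longrightarrow> fst ((Q ^^ m) v) = (A ^^ m) (fst v)"
  by (induction m) (simp_all add: Q_fst Q_pow)

lemma filt_one_eq_incl:
  assumes "v \<in> filt 1"
  shows "v = incl (fst v)" and "fst v \<in> carrier H"
proof -
  have v: "v \<in> carrier E" using assms by (simp add: filt_def)
  then show fst: "fst v \<in> carrier H" by (simp add: graded_carrier)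
  show "v = incl (fst v)"
    by (rule graded_eq_componentI)
      (use v fst assms in \<open>simp_all add: incl_eq_homogeneous homogeneous_closed
        component_homogeneous filt_def homogeneous_fst\<close>)
qed

lemma Q_pow_h_eq_zero:
  assumes root: "(q\<^sup>2) ^ h = 1" "\<And>j. \<lbrakk>0 < j; j < h\<rbrakk> \<Longrightarrow> (q\<^sup>2) ^ j \<noteq> 1"
    and A_h: "\<And>x. x \<in> carrier H \<Longrightarrow> (A ^^ h) x = \<zero>"
    and "v \<in> carrier E"
  shows "(Q ^^ h) v = \<zero>\<^bsub>E\<^esub>"
proof (rule filt.Q_pow_eq_zero_if_on_F_one[OF _ assms(4)])
  fix v assume "v \<in> filt 1"
  from filt_one_eq_incl[OF this] obtain x where x: "v = incl x" "x \<in> carrier H" by blast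
  have inclE: "incl x \<in> carrier E" using x by (simp add: incl_eq_homogeneous homogeneous_closed)
  show "(Q ^^ h) v = \<zero>\<^bsub>E\<^esub>"
  proof (rule graded_eq_componentI)
    show "fst ((Q ^^ h) v) = fst \<zero>\<^bsub>E\<^esub>"
      using x inclE A_h by (simp add: Q_pow_fst graded_zero) (simp add: graded_incl_def A_h)
    fix n assume n: "Suc n < h"
    have "gauss_binomial (q\<^sup>2) h (Suc n) = 0"
      by (rule gauss_binomial_root_of_unity) (use root n in auto)
    then have "component (Suc n) ((Q ^^ h) v) = W"
      using n x A_pow_simps(1) smult_l_null by (simp add: component_Q_pow_incl coset_zero)
    then show "component (Suc n) ((Q ^^ h) v) = component (Suc n) \<zero>\<^bsub>E\<^esub>"
      using n by (simp add: component_def graded_zero V_zero)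
  qed (use x inclE Q_pow(1) in auto)
qed

lemma incl_hom: "incl \<in> module_hom complex_field (H\<lparr>carrier := W\<rparr>) E"
proof (rule module_homI)
  have W: "x \<in> carrier H" if "x \<in> W" for x using that submoduleE(1)[OF W_submodule] by blast
  show "incl x \<in> carrier E" if "x \<in> carrier (H\<lparr>carrier := W\<rparr>)" for x
    using that W by (simp add: incl_eq_homogeneous homogeneous_closed)
qed (auto simp: graded_incl_def graded_add graded_smult fun_eq_iff)

lemma incl_bij: "bij_betw incl W (filt 0)"
proof -
  have W: "x \<in> carrier H" if "x \<in> W" for x using that submoduleE(1)[OF W_submodule] by blast
  have "incl x \<in> filt 0" if "x \<in> W" for x
    using that W coset_eq_self_iff[OF W_submodule]
    by (auto simp: filt_def incl_eq_homogeneous homogeneous_closed component_homogeneous)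
  moreover have "v \<in> incl ` W" if v: "v \<in> filt 0" for v
  proof -
    have "v \<in> filt 1" using v by (auto simp: filt_def)
    note v' = filt_one_eq_incl[OF this]
    have "W +> fst v = W" using v h_pos by (auto simp: filt_def component_def)
    then have "fst v \<in> W" using coset_eq_self_iff[OF W_submodule v'(2)] by simp
    then show ?thesis using v'(1) by blast
  qed
  moreover have "inj_on incl W" by (rule inj_onI) (simp add: graded_incl_def)
  ultimately show ?thesis by (auto simp: bij_betw_def)
qed

text \<open>Both \<open>Q (incl x)\<close> and \<open>incl (A x)\<close> lie in \<open>F 0\<close>, where an element is determined by its
  coordinate in \<open>H\<close>.\<close>

lemma incl_A:
  assumes "x \<in> W"
  shows "incl (A x) = Q (incl x)"
proof -
  have "incl x \<in> filt 0" using assms incl_bij by (auto simp: bij_betw_def)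
  then have *: "Q (incl x) \<in> filt 0" by (rule filt.Q_F_zero)
  then have "Q (incl x) \<in> filt 1" by (auto simp: filt_def)
  from filt_one_eq_incl(1)[OF this] show ?thesis
    using \<open>incl x \<in> filt 0\<close> by (simp add: filt_def Q_fst graded_incl_def)
qed

end

lemma exp_pi_over_h_primitive_root:
  fixes h :: nat
  assumes "0 < h" and q: "q = exp (\<i> * of_real pi / of_nat h)"
  shows "(q\<^sup>2) ^ h = 1" and "\<And>j. \<lbrakk>0 < j; j < h\<rbrakk> \<Longrightarrow> (q\<^sup>2) ^ j \<noteq> 1"
proof -
  have q_cis: "(q\<^sup>2) ^ j = cis (2 * pi * (real j / real h))" for j
  proof -
    have "q = cis (pi / real h)" using q by (simp add: cis_conv_exp)
    then show ?thesis by (simp add: DeMoivre algebra_simps flip: power_mult)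
  qed
  show "(q\<^sup>2) ^ h = 1" using assms(1) by (simp add: q_cis)
  fix j assume j: "0 < j" "j < h"
  show "(q\<^sup>2) ^ j \<noteq> 1"
  proof
    assume "(q\<^sup>2) ^ j = 1"
    then have "cos (2 * pi * (real j / real h)) = 1"
      unfolding q_cis by (simp add: complex_eq_iff)
    then obtain k :: int where "2 * pi * (real j / real h) = of_int k * 2 * pi"
      unfolding cos_one_2pi_int by blast
    then have "2 * pi * (real j / real h) = 2 * pi * of_int k"
      by (simp only: mult_ac)
    then have "real j / real h = of_int k"
      unfolding mult_cancel_left by simp
    moreover have "0 < real j / real h" "real j / real h < 1" using j by auto
    ultimately show False by simp
  qed
qed

theorem theorem1:
  fixes h :: nat and q :: complex
    and H :: "(complex, 'a) module" and H\<^sub>I :: "'a set" and A :: "'a \<Rightarrow> 'a"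
  assumes "h \<ge> 2"
    and "q = exp (\<i> * of_real pi / of_nat h)"
    and "differential_space h H A"
    and "submodule H\<^sub>I complex_field H"
    and "A ` H\<^sub>I \<subseteq> H\<^sub>I"
  shows "\<forall>k \<in> {1..h - 1}.
    \<exists>\<phi> \<in> module_iso complex_field
            (gen_homology h k (H\<lparr>carrier := H\<^sub>I\<rparr>) A)
            (gen_homology h k (graded_space h H H\<^sub>I) (graded_Q h q H H\<^sub>I A)).
      \<forall>x \<in> a_kernel (H\<lparr>carrier := H\<^sub>I\<rparr>) (H\<lparr>carrier := H\<^sub>I\<rparr>) (A ^^ k).
        \<phi> (((A ^^ (h - k)) ` H\<^sub>I) +>\<^bsub>H\<^esub> x) =
          ((graded_Q h q H H\<^sub>I A ^^ (h - k)) ` carrier (graded_space h H H\<^sub>I))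
            +>\<^bsub>graded_space h H H\<^sub>I\<^esub> graded_incl h H H\<^sub>I x"
proof
  fix k assume k: "k \<in> {1..h - 1}"
  have Hm: "module complex_field H" and A: "A \<in> module_hom complex_field H H"
    and A_h: "\<And>x. x \<in> carrier H \<Longrightarrow> (A ^^ h) x = \<zero>\<^bsub>H\<^esub>"
    using assms(3) by (auto simp: differential_space_def)
  have h: "0 < h" using assms(1) by simp
  have k_le: "k \<le> h" using k by auto
  interpret graded_extension H "H\<^sub>I" A h q
    by (intro graded_extension.intro graded_extension_axioms.intro Hm h A assms(4,5))
  have sub: "H\<^sub>I \<subseteq> carrier H" using submoduleE(1)[OF assms(4)] .
  let ?L = "H\<lparr>carrier := H\<^sub>I\<rparr>"
  have L: "differential_space h ?L A"
    using sub A_h A_simps assms(5) submodule.submodule_is_module[OF assms(4) Hm]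
    by (auto simp: differential_space_def subset_iff intro!: module_homI)
  have Qh: "(graded_Q h q H H\<^sub>I A ^^ h) v = \<zero>\<^bsub>graded_space h H H\<^sub>I\<^esub>"
    if "v \<in> carrier (graded_space h H H\<^sub>I)" for v
    by (rule Q_pow_h_eq_zero[OF exp_pi_over_h_primitive_root[OF h assms(2)] A_h that])
  have coset: "X +>\<^bsub>?L\<^esub> x = X +>\<^bsub>H\<^esub> x" for X x
    by (simp add: a_r_coset_def')
  show "\<exists>\<phi> \<in> module_iso complex_field (gen_homology h k ?L A)
            (gen_homology h k (graded_space h H H\<^sub>I) (graded_Q h q H H\<^sub>I A)).
      \<forall>x \<in> a_kernel ?L ?L (A ^^ k).
        \<phi> (((A ^^ (h - k)) ` H\<^sub>I) +>\<^bsub>H\<^esub> x) =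
          ((graded_Q h q H H\<^sub>I A ^^ (h - k)) ` carrier (graded_space h H H\<^sub>I))
            +>\<^bsub>graded_space h H H\<^sub>I\<^esub> graded_incl h H H\<^sub>I x"
    using filt.gen_homology_F_zero_iso[OF L Qh incl_hom, of k] incl_bij incl_A k_le
    by (simp add: coset)
qed

end
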